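(* Let $k \ge 1$ and let $G = P_k \square P_2$ be the ladder graph. Then $\textrm{RED:LD}(G) = k+1$ if $k$ is odd and $\textrm{RED:LD}(G) = k+2$ if $k$ is even.
   Context: $P_k$ is the path on $k$ vertices and $\square$ denotes the Cartesian product of graphs. $N(v)$ denotes the open neighborhood of $v$. A set $S \subseteq V(G)$ is a locating-dominating (LD) set if for all $u,v \in V(G)-S$: $N(v)\cap S \neq \varnothing$, and if $u \ne v$ then $N(v) \cap S \neq N(u) \cap S$. A RED:LD set is an LD set $S$ such that $S-\{v\}$ is an LD set for every $v \in S$. $\textrm{RED:LD}(G)$ is the minimum cardinality of a RED:LD set of $G$. *)

theory Defs
  imports "Graph_Theory.Pair_Digraph"
begin

text \<open>A finite simple graph is a \<open>pair_graph\<close>: each edge is stored as its two opposite arcs.\<close>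

definition path_graph :: "nat \<Rightarrow> nat pair_pre_digraph" where
  "path_graph k =
     \<lparr> pverts = {..<k}, parcs = {(i, j). i < k \<and> j < k \<and> (j = Suc i \<or> i = Suc j)} \<rparr>"

definition cartesian_product ::
    "'a pair_pre_digraph \<Rightarrow> 'b pair_pre_digraph \<Rightarrow> ('a \<times> 'b) pair_pre_digraph"
    (infixl "\<box>" 70) where
  "G \<box> H =
     \<lparr> pverts = pverts G \<times> pverts H,
       parcs = {((a, b), (a', b')).
         (a = a' \<and> a \<in> pverts G \<and> (b, b') \<in> parcs H) \<or>
         (b = b' \<and> b \<in> pverts H \<and> (a, a') \<in> parcs G)} \<rparr>"

definition open_nbhd :: "'a pair_pre_digraph \<Rightarrow> 'a \<Rightarrow> 'a set" where
  "open_nbhd G v = {u \<in> pverts G. (v, u) \<in> parcs G}"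

definition LD_set :: "'a pair_pre_digraph \<Rightarrow> 'a set \<Rightarrow> bool" where
  "LD_set G S \<longleftrightarrow> S \<subseteq> pverts G \<and>
     (\<forall>u \<in> pverts G - S. \<forall>v \<in> pverts G - S.
        open_nbhd G v \<inter> S \<noteq> {} \<and>
        (u \<noteq> v \<longrightarrow> open_nbhd G v \<inter> S \<noteq> open_nbhd G u \<inter> S))"

definition RED_LD_set :: "'a pair_pre_digraph \<Rightarrow> 'a set \<Rightarrow> bool" where
  "RED_LD_set G S \<longleftrightarrow> LD_set G S \<and> (\<forall>v \<in> S. LD_set G (S - {v}))"

text \<open>If \<open>G\<close> has no RED:LD set, the value below is unspecified.\<close>

definition RED_LD :: "'a pair_pre_digraph \<Rightarrow> nat" where
  "RED_LD G = (LEAST n. \<exists>S. RED_LD_set G S \<and> card S = n)"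

lemma pair_graph_path_graph: "pair_graph (path_graph k)"
proof -
  have "finite (parcs (path_graph k))"
    by (rule finite_subset[of _ "{..<k} \<times> {..<k}"]) (auto simp: path_graph_def)
  then show ?thesis
    by unfold_locales (auto simp: path_graph_def symmetric_def intro!: symI)
qed

lemma pair_graph_cartesian_product:
  assumes "pair_graph G" "pair_graph H"
  shows "pair_graph (G \<box> H)"
proof -
  interpret G: pair_graph G by fact
  interpret H: pair_graph H by fact
  have symG: "(a, b) \<in> parcs G \<longleftrightarrow> (b, a) \<in> parcs G" for a b
    using G.pair_sym_arcs unfolding symmetric_def with_proj_simps by (meson symD)
  have symH: "(a, b) \<in> parcs H \<longleftrightarrow> (b, a) \<in> parcs H" for a b
    using H.pair_sym_arcs unfolding symmetric_def with_proj_simps by (meson symD)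
  have arc: "e \<in> parcs (G \<box> H) \<Longrightarrow>
      fst e \<in> pverts (G \<box> H) \<and> snd e \<in> pverts (G \<box> H) \<and> fst e \<noteq> snd e" for e
    unfolding cartesian_product_def
    using G.arc_fst_in_verts G.arc_snd_in_verts G.pair_no_loops
      H.arc_fst_in_verts H.arc_snd_in_verts H.pair_no_loops
    by (cases e) fastforce
  have fin: "finite (pverts (G \<box> H))"
    using G.pair_finite_verts H.pair_finite_verts by (simp add: cartesian_product_def)
  show ?thesis
  proof unfold_locales
    show "finite (pverts (G \<box> H))" by (fact fin)
    show "finite (parcs (G \<box> H))"
      using arc fin by (intro finite_subset[of "parcs (G \<box> H)" "pverts (G \<box> H) \<times> pverts (G \<box> H)"])
        (auto simp: mem_Times_iff)
    show "symmetric (with_proj (G \<box> H))"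
      unfolding symmetric_def with_proj_simps
    proof (rule symI)
      fix x y
      assume "(x, y) \<in> parcs (G \<box> H)"
      then show "(y, x) \<in> parcs (G \<box> H)"
        using symG[of "fst x" "fst y"] symH[of "snd x" "snd y"]
        by (cases x; cases y) (auto simp: cartesian_product_def)
    qed
  qed (use arc in blast)+
qed

end

theory Submission
  imports Defs
begin

text \<open>Lower bound: let \<open>c i\<close> be the number of chosen vertices in column \<open>i\<close>. Redundant domination
forces both neighbouring columns of an empty column to exist and to be full, and a corner column
with one chosen vertex to be followed by a full column; separating the unchosen corner from the
vertex diagonally opposite to it then forces the third column to be nonempty. Hence, after the
columns with \<open>c i = 1\<close> are deleted, no two empty columns are consecutive and both ends are full, so
the full columns outnumber the empty ones. If they do so by exactly one, full and empty columns
alternate and either there are no columns with \<open>c i = 1\<close> or the counts are \<open>1, 2, 1\<close>; so \<open>k\<close> is odd.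
Upper bound: take every other column, together with the last one.\<close>

section \<open>Consequences of redundancy in an arbitrary graph\<close>

lemma LD_set_mono:
  assumes "LD_set G S" "S \<subseteq> T" "T \<subseteq> pverts G"
  shows "LD_set G T"
  unfolding LD_set_def
proof (intro conjI ballI impI)
  fix u v assume uv: "u \<in> pverts G - T" "v \<in> pverts G - T"
  then show "open_nbhd G v \<inter> T \<noteq> {}"
    using assms unfolding LD_set_def by blast
  assume "u \<noteq> v"
  then have "open_nbhd G v \<inter> S \<noteq> open_nbhd G u \<inter> S"
    using uv assms unfolding LD_set_def by blast
  then show "open_nbhd G v \<inter> T \<noteq> open_nbhd G u \<inter> T"
    using assms(2) by blast
qed (fact assms(3))

lemma RED_LD_set_Diff: "RED_LD_set G S \<Longrightarrow> LD_set G (S - {w})"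
  by (cases "w \<in> S") (auto simp: RED_LD_set_def)

text \<open>Since \<open>S - {w}\<close> still dominates \<open>v\<close>, and \<open>w\<close> is
  arbitrary, an unchosen vertex has at least two chosen neighbours.\<close>

lemma RED_LD_set_dominated:
  assumes "RED_LD_set G S" "v \<in> pverts G" "v \<notin> S"
  obtains x where "x \<in> open_nbhd G v" "x \<in> S" "x \<noteq> w"
  using RED_LD_set_Diff[OF assms(1), of w] assms(2,3) unfolding LD_set_def by blast

lemma RED_LD_set_dominated_self:
  assumes "RED_LD_set G S" "v \<in> S"
  obtains x where "x \<in> open_nbhd G v" "x \<in> S" "x \<noteq> v"
proof -
  have "v \<in> pverts G"
    using assms unfolding RED_LD_set_def LD_set_def by blast
  then show ?thesis
    using RED_LD_set_Diff[OF assms(1), of v] assms(2) that unfolding LD_set_def by blast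
qed

text \<open>Once \<open>v\<close> is deleted, both vertices lie outside the remaining set, which
  must still tell them apart.\<close>

lemma RED_LD_set_separated:
  assumes "RED_LD_set G S" "u \<in> pverts G" "u \<notin> S" "v \<in> S"
  shows "open_nbhd G u \<inter> (S - {v}) \<noteq> open_nbhd G v \<inter> (S - {v})"
proof -
  have "v \<in> pverts G"
    using assms unfolding RED_LD_set_def LD_set_def by blast
  moreover have "u \<noteq> v" using assms by blast
  ultimately show ?thesis
    using RED_LD_set_Diff[OF assms(1), of v] assms(2,3) unfolding LD_set_def by blast
qed

text \<open>Here \<open>x\<close> and \<open>y\<close> model an end column with only
  \<open>x\<close> chosen, and \<open>x'\<close>, \<open>y'\<close> their horizontal neighbours.
  Deleting \<open>x\<close> forces \<open>x'\<close> to be chosen; \<open>y\<close> needs two chosen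
  neighbours, which must be \<open>x\<close> and \<open>y'\<close>. Deleting \<open>x'\<close> would
  leave \<open>x'\<close> and \<open>y\<close> both with trace \<open>{x, y'}\<close> unless
  \<open>x'\<close> has a further chosen neighbour.\<close>

lemma RED_LD_set_corner:
  assumes S: "RED_LD_set G S" and y: "y \<in> pverts G" "y \<notin> S" and x: "x \<in> S"
    and Nx: "open_nbhd G x \<subseteq> {x', y}" and Ny: "open_nbhd G y \<subseteq> {y', x}"
    and Nx': "{x, y'} \<subseteq> open_nbhd G x'" and neq: "x' \<noteq> y'" "x \<noteq> x'"
  shows "x' \<in> S" "y' \<in> S" "\<exists>z \<in> open_nbhd G x' \<inter> S. z \<noteq> x \<and> z \<noteq> y'"
proof -
  show x': "x' \<in> S"
    using RED_LD_set_dominated_self[OF S x] Nx y by blast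
  obtain z where z: "z \<in> open_nbhd G y" "z \<in> S" "z \<noteq> x"
    using RED_LD_set_dominated[OF S y, of x] by blast
  then show y': "y' \<in> S" using Ny by blast
  obtain t where t: "t \<in> open_nbhd G y" "t \<in> S" "t \<noteq> y'"
    using RED_LD_set_dominated[OF S y, of y'] by blast
  \<comment> \<open>The witness \<open>z\<close> can only be \<open>y'\<close>, and \<open>t\<close>
    only \<open>x\<close>, so both bounds in \<open>Ny\<close> are attained.\<close>
  have "open_nbhd G y = {y', x}" using Ny z t by blast
  then show "\<exists>z \<in> open_nbhd G x' \<inter> S. z \<noteq> x \<and> z \<noteq> y'"
    using RED_LD_set_separated[OF S y x'] Nx' neq x y' by blast
qed

section \<open>Coordinates on the ladder and counting by columns\<close>

lemma pverts_ladder: "pverts (path_graph k \<box> path_graph n) = {..<k} \<times> {..<n}"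
  by (simp add: cartesian_product_def path_graph_def)

lemma open_nbhd_ladder:
  "(j, b) \<in> open_nbhd (path_graph k \<box> path_graph 2) (i, a) \<longleftrightarrow>
     i < k \<and> j < k \<and> a < 2 \<and> b < 2 \<and> (i = j \<and> a \<noteq> b \<or> a = b \<and> (j = Suc i \<or> i = Suc j))"
  by (auto simp: open_nbhd_def cartesian_product_def path_graph_def)

definition column_count :: "(nat \<times> nat) set \<Rightarrow> nat \<Rightarrow> nat" where
  "column_count S i = card {a. (i, a) \<in> S}"

lemma column_count_two_rows:
  assumes "S \<subseteq> A \<times> {..<2}"
  shows "column_count S i = of_bool ((i, 0) \<in> S) + of_bool ((i, 1) \<in> S)"
proof -
  have "{a. (i, a) \<in> S} = {a \<in> {..<2}. (i, a) \<in> S}" using assms by blast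
  also have "\<dots> = (if (i, 0) \<in> S then {0} else {}) \<union> (if (i, 1) \<in> S then {1} else {})"
    by (auto simp: less_2_cases_iff intro!: gr0I split: if_splits)
  finally show ?thesis unfolding column_count_def by simp
qed

lemma card_eq_sum_column_count:
  assumes "S \<subseteq> {..<k} \<times> {..<n}"
  shows "card S = (\<Sum>i<k. column_count S i)"
proof -
  have fin: "finite {a. (i, a) \<in> S}" for i
    by (rule finite_subset[of _ "{..<n}"]) (use assms in auto)
  have "S = (SIGMA i:{..<k}. {a. (i, a) \<in> S})" using assms by auto
  then have "card S = card (SIGMA i:{..<k}. {a. (i, a) \<in> S})" by simp
  also have "\<dots> = (\<Sum>i<k. column_count S i)"
    unfolding column_count_def using fin by simp
  finally show ?thesis .
qed

section \<open>Lower bound for an arbitrary redundant set on the ladder\<close>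

locale ladder_RED_LD =
  fixes k :: nat and S :: "(nat \<times> nat) set"
  assumes RED: "RED_LD_set (path_graph k \<box> path_graph 2) S"
begin

lemma subset: "S \<subseteq> {..<k} \<times> {..<2}"
  using RED unfolding RED_LD_set_def LD_set_def pverts_ladder by blast

lemma column_count: "column_count S i = of_bool ((i, 0) \<in> S) + of_bool ((i, 1) \<in> S)"
  by (rule column_count_two_rows[OF subset])

lemma column_count_le: "column_count S i \<le> 2"
  by (simp add: column_count)

text \<open>Each vertex of an empty column has two chosen neighbours; its partner in the column is
  unchosen, so both horizontal neighbours exist and are chosen.\<close>

lemma column_count_zero:
  assumes "i < k" "column_count S i = 0"
  shows "0 < i" "Suc i < k" "column_count S (i - 1) = 2" "column_count S (Suc i) = 2"
proof -
  have out: "(i, a) \<notin> S" if "a < 2" for a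
    using assms that by (auto simp: column_count less_2_cases_iff)
  have right: "(Suc i, a) \<in> S" if a: "a < 2" for a
  proof -
    \<comment> \<open>For \<open>i = 0\<close> truncated subtraction makes the excluded vertex
      \<open>(0, a)\<close> itself, which is not its own neighbour, so nothing is lost.\<close>
    obtain x where "x \<in> open_nbhd (path_graph k \<box> path_graph 2) (i, a)" "x \<in> S" "x \<noteq> (i - 1, a)"
      by (rule RED_LD_set_dominated[OF RED, of "(i, a)" "(i - 1, a)"])
        (use assms out a in \<open>auto simp: pverts_ladder\<close>)
    then show ?thesis using out by (cases x) (auto simp: open_nbhd_ladder)
  qed
  have left: "0 < i \<and> (i - 1, a) \<in> S" if a: "a < 2" for a
  proof -
    obtain x where "x \<in> open_nbhd (path_graph k \<box> path_graph 2) (i, a)" "x \<in> S" "x \<noteq> (Suc i, a)"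
      by (rule RED_LD_set_dominated[OF RED, of "(i, a)" "(Suc i, a)"])
        (use assms out a in \<open>auto simp: pverts_ladder\<close>)
    then show ?thesis using out by (cases x) (auto simp: open_nbhd_ladder)
  qed
  show "0 < i" using left[of 0] by simp
  show "Suc i < k" using right[of 0] subset by auto
  show "column_count S (i - 1) = 2" using left[of 0] left[of 1] by (simp add: column_count)
  show "column_count S (Suc i) = 2" using right[of 0] right[of 1] by (simp add: column_count)
qed

lemma column_count_oneE:
  assumes "column_count S i = 1"
  obtains a b where "a = 0 \<and> b = 1 \<or> a = 1 \<and> b = 0" "(i, a) \<in> S" "(i, b) \<notin> S"
proof (cases "(i, 0) \<in> S")
  case True
  then show ?thesis using assms that[of 0 1] by (simp add: column_count)
next
  case False
  then have "(i, 1) \<in> S" using assms by (cases "(i, 1) \<in> S") (simp_all add: column_count)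
  with False show ?thesis using that[of 1 0] by simp
qed

text \<open>The corner lemma applies with \<open>(0, a)\<close> chosen and \<open>(0, b)\<close>
  not; the further neighbour of \<open>(1, a)\<close> that it provides can only be
  \<open>(2, a)\<close>.\<close>

lemma column_count_first:
  assumes "0 < k" "column_count S 0 = 1"
  shows "2 < k" "column_count S 1 = 2" "0 < column_count S 2"
proof -
  obtain a b where ab: "a = 0 \<and> b = 1 \<or> a = 1 \<and> b = 0" "(0, a) \<in> S" "(0, b) \<notin> S"
    using column_count_oneE[OF assms(2)] .
  have ab': "a < 2" "b < 2" "a \<noteq> b" using ab(1) by auto
  \<comment> \<open>The unchosen corner needs a chosen neighbour besides \<open>(0, a)\<close>,
    which must lie in column 1.\<close>
  have k: "1 < k"
  proof -
    obtain x where "x \<in> open_nbhd (path_graph k \<box> path_graph 2) (0, b)" "x \<in> S" "x \<noteq> (0, a)"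
      by (rule RED_LD_set_dominated[OF RED, of "(0, b)" "(0, a)"])
        (use assms ab(3) ab' in \<open>simp_all add: pverts_ladder\<close>)
    then show ?thesis using ab(1,3) by (cases x) (auto simp: open_nbhd_ladder)
  qed
  have Nx: "open_nbhd (path_graph k \<box> path_graph 2) (0, a) \<subseteq> {(1, a), (0, b)}"
    and Ny: "open_nbhd (path_graph k \<box> path_graph 2) (0, b) \<subseteq> {(1, b), (0, a)}"
    and Nx': "{(0, a), (1, b)} \<subseteq> open_nbhd (path_graph k \<box> path_graph 2) (1, a)"
    using ab(1) k by (auto simp: open_nbhd_ladder)
  have "(0, b) \<in> pverts (path_graph k \<box> path_graph 2)"
    using ab' k by (simp add: pverts_ladder)
  note corner = RED_LD_set_corner[OF RED this ab(3,2) Nx Ny Nx']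
  have "(1, a) \<in> S" "(1, b) \<in> S"
    and z: "\<exists>z \<in> open_nbhd (path_graph k \<box> path_graph 2) (1, a) \<inter> S. z \<noteq> (0, a) \<and> z \<noteq> (1, b)"
    using corner ab' by simp_all
  then show "column_count S 1 = 2" using ab(1) by (auto simp: column_count)
  have "(Suc 1, a) \<in> S" using z ab(1) by (auto simp: open_nbhd_ladder)
  then have a2: "(2, a) \<in> S" by (simp add: numeral_2_eq_2)
  then show "2 < k" using subset by auto
  show "0 < column_count S 2" using a2 ab(1) by (auto simp: column_count)
qed

text \<open>Mirror image of \<open>column_count_first\<close>. The further neighbour of
  \<open>(m, a)\<close> can only be \<open>(m - 1, a)\<close>, which also forces
  \<open>0 < m\<close>.\<close>

lemma column_count_last:
  assumes "0 < k" "column_count S (k - 1) = 1"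
  shows "2 < k" "column_count S (k - 2) = 2" "0 < column_count S (k - 3)"
proof -
  obtain a b where ab: "a = 0 \<and> b = 1 \<or> a = 1 \<and> b = 0" "(k - 1, a) \<in> S" "(k - 1, b) \<notin> S"
    using column_count_oneE[OF assms(2)] .
  have ab': "a < 2" "b < 2" "a \<noteq> b" using ab(1) by auto
  have "1 < k"
  proof -
    obtain x where "x \<in> open_nbhd (path_graph k \<box> path_graph 2) (k - 1, b)" "x \<in> S"
        "x \<noteq> (k - 1, a)"
      by (rule RED_LD_set_dominated[OF RED, of "(k - 1, b)" "(k - 1, a)"])
        (use assms ab(3) ab' in \<open>simp_all add: pverts_ladder\<close>)
    then show ?thesis using ab(1,3) by (cases x) (auto simp: open_nbhd_ladder)
  qed
  define m where "m = k - 2"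
  have m: "k = Suc (Suc m)" using \<open>1 < k\<close> by (simp add: m_def)
  have corner_S: "(Suc m, b) \<notin> S" "(Suc m, a) \<in> S" using ab m by simp_all
  have Nx: "open_nbhd (path_graph k \<box> path_graph 2) (Suc m, a) \<subseteq> {(m, a), (Suc m, b)}"
    and Ny: "open_nbhd (path_graph k \<box> path_graph 2) (Suc m, b) \<subseteq> {(m, b), (Suc m, a)}"
    and Nx': "{(Suc m, a), (m, b)} \<subseteq> open_nbhd (path_graph k \<box> path_graph 2) (m, a)"
    using ab(1) m by (auto simp: open_nbhd_ladder)
  have "(Suc m, b) \<in> pverts (path_graph k \<box> path_graph 2)"
    using ab' m by (simp add: pverts_ladder)
  note corner = RED_LD_set_corner[OF RED this corner_S Nx Ny Nx']
  have in_S: "(m, a) \<in> S" "(m, b) \<in> S"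
    and z: "\<exists>z \<in> open_nbhd (path_graph k \<box> path_graph 2) (m, a) \<inter> S.
              z \<noteq> (Suc m, a) \<and> z \<noteq> (m, b)"
    using corner ab' by simp_all
  from in_S show "column_count S (k - 2) = 2" using ab(1) m by (auto simp: column_count)
  have "0 < m \<and> (m - 1, a) \<in> S" using z ab(1) by (auto simp: open_nbhd_ladder)
  moreover have "k - 3 = m - 1" using m by simp
  ultimately show "2 < k" "0 < column_count S (k - 3)"
    using ab(1) m by (auto simp: column_count)
qed

text \<open>An invariant on prefixes, tracking the last count and the excess of the sum over
  \<open>n\<close>; each column changes the excess by its count minus one. The two tight cases,
  excess 0 after an empty column and excess 1 after a full one, can only arise from each other,
  which fixes the parity. A column with count 1 is never next to an empty one, so a full column
  after it has excess at least 2.\<close>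

lemma sum_column_count_from_full:
  assumes "column_count S 0 = 2" "0 < n" "n \<le> k"
  shows "n \<le> (\<Sum>i<n. column_count S i) \<and>
    (column_count S (n - 1) = 0 \<longrightarrow> (\<Sum>i<n. column_count S i) = n \<longrightarrow> even n) \<and>
    (column_count S (n - 1) \<noteq> 0 \<longrightarrow> n < (\<Sum>i<n. column_count S i)) \<and>
    (column_count S (n - 1) = 2 \<longrightarrow> (\<Sum>i<n. column_count S i) = n + 1 \<longrightarrow> odd n)"
  using assms(2,3)
proof (induction n rule: nat_induct_non_zero)
  case 1
  then show ?case using assms(1) by simp
next
  case (Suc n)
  have "column_count S n = 0 \<Longrightarrow> column_count S (n - 1) = 2"
    "column_count S (n - 1) = 0 \<Longrightarrow> column_count S n = 2"
    using column_count_zero(3)[of n] column_count_zero(4)[of "n - 1"] Suc.hyps Suc.prems by auto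
  moreover have "column_count S n \<in> {0, 1, 2}" "column_count S (n - 1) \<in> {0, 1, 2}"
    using column_count_le[of n] column_count_le[of "n - 1"] by auto
  ultimately show ?case using Suc by auto
qed

text \<open>No parity bookkeeping is needed here: the first three columns already contain at least four
vertices.\<close>

lemma sum_column_count_from_single:
  assumes "column_count S 0 = 1" "3 \<le> n" "n \<le> k"
  shows "n < (\<Sum>i<n. column_count S i) \<and>
    (column_count S (n - 1) = 2 \<longrightarrow> n + 1 < (\<Sum>i<n. column_count S i))"
  using assms(2,3)
proof (induction n rule: dec_induct)
  case base
  then show ?case using assms(1) column_count_first by (auto simp: eval_nat_numeral)
next
  case (step n)
  have "column_count S n = 0 \<Longrightarrow> column_count S (n - 1) = 2"
    using column_count_zero(3)[of n] step by auto
  moreover have "column_count S n \<in> {0, 1, 2}"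
    using column_count_le[of n] by auto
  ultimately show ?case using step by auto
qed

lemma card_ge:
  assumes "0 < k"
  shows "k + (if odd k then 1 else 2) \<le> card S"
proof -
  let ?T = "\<lambda>n. \<Sum>i<n. column_count S i"
  have T: "card S = ?T k" by (rule card_eq_sum_column_count[OF subset])
  have last: "column_count S (k - 1) = 1 \<or> column_count S (k - 1) = 2"
    using column_count_zero(2)[of "k - 1"] column_count_le[of "k - 1"] assms by fastforce
  have "column_count S 0 = 1 \<or> column_count S 0 = 2"
    using column_count_zero(1)[of 0] column_count_le[of 0] assms by fastforce
  then show ?thesis
  proof
    assume c0: "column_count S 0 = 2"
    from last show ?thesis
    proof
      assume "column_count S (k - 1) = 2"
      then show ?thesis
        using sum_column_count_from_full[OF c0, of k] assms T by force
    next
      assume c: "column_count S (k - 1) = 1"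
      note l = column_count_last[OF assms c]
      obtain m where m: "k = Suc (Suc m)" "0 < m"
        using l(1) by (metis Suc_lessE not_less_eq numeral_2_eq_2 gr0_conv_Suc)
      \<comment> \<open>The last two columns contribute 2 and 1, and the prefix before them ends in
        a nonempty column; the total is at least \<open>(m + 1) + 3 = k + 2\<close>.\<close>
      have "m < ?T m"
        using sum_column_count_from_full[OF c0, of m] m l(3) by (simp add: eval_nat_numeral)
      then show ?thesis using T c l(2) m by (simp add: eval_nat_numeral)
    qed
  next
    assume c0: "column_count S 0 = 1"
    note f = column_count_first[OF assms c0]
    from last show ?thesis
    proof
      assume "column_count S (k - 1) = 2"
      then show ?thesis
        using sum_column_count_from_single[OF c0, of k] f T by force
    next
      assume c: "column_count S (k - 1) = 1"
      note l = column_count_last[OF assms c]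
      show ?thesis
      \<comment> \<open>For counts 1, 2, 1 the bound 4 suffices, as 3 is odd. Otherwise the prefix
        without the last column has at least three columns and ends in a full one, which gives one
        more vertex.\<close>
      proof (cases "k = 3")
        case True
        then show ?thesis using sum_column_count_from_single[OF c0, of k] T by simp
      next
        case False
        obtain m where m: "k = Suc m" "3 \<le> m" using False f(1) by (cases k) auto
        then have "m + 1 < ?T m"
          using sum_column_count_from_single[OF c0, of m] l(2) by (simp add: eval_nat_numeral)
        then show ?thesis using T c m by simp
      qed
    qed
  qed
qed

end

section \<open>Upper bound by an explicit set\<close>

definition alternate_columns :: "nat \<Rightarrow> (nat \<times> nat) set" where
  "alternate_columns k = {i. i < k \<and> (even i \<or> Suc i = k)} \<times> {..<2}"

lemma mem_alternate_columns:
  "(i, a) \<in> alternate_columns k \<longleftrightarrow> i < k \<and> (even i \<or> Suc i = k) \<and> a < 2"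
  by (auto simp: alternate_columns_def)

lemma card_alternate_columns:
  assumes "0 < k"
  shows "card (alternate_columns k) = k + (if odd k then 1 else 2)"
proof -
  let ?E = "(\<lambda>j. 2 * j) ` {..<(k + 1) div 2}"
  have E: "?E = {i. i < k \<and> even i}" by (auto elim!: evenE)
  have card_E: "card ?E = (k + 1) div 2" by (simp add: card_image inj_on_def)
  have "card {i. i < k \<and> (even i \<or> Suc i = k)} = (if odd k then (k + 1) div 2 else (k + 1) div 2 + 1)"
  proof (cases "odd k")
    case True
    then have "{i. i < k \<and> (even i \<or> Suc i = k)} = ?E" unfolding E by auto
    then show ?thesis using True card_E by simp
  next
    case False
    \<comment> \<open>Here the last column has odd index; left out, its vertices would have only one
      chosen neighbour each, since nothing lies to their right.\<close>
    then have "{i. i < k \<and> (even i \<or> Suc i = k)} = insert (k - 1) ?E" "k - 1 \<notin> ?E"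
      unfolding E using assms by auto
    then show ?thesis using False card_E by simp
  qed
  moreover have "card (alternate_columns k) = 2 * card {i. i < k \<and> (even i \<or> Suc i = k)}"
    by (simp add: alternate_columns_def card_cartesian_product)
  ultimately show ?thesis by (simp; presburger)
qed

lemma other_row:
  fixes a :: nat
  obtains c :: nat where "c < 2" "c \<noteq> a"
  using that[of 0] that[of 1] by fastforce

text \<open>Only \<open>u\<close> may be the deleted vertex. The vertex \<open>v\<close> lies in an
  odd column between two chosen ones, and so does \<open>u\<close> unless \<open>u = w\<close>. In
  each case two candidate vertices distinguish \<open>u\<close> from \<open>v\<close> and at most
  one is lost with \<open>w\<close>, or a single one survives for certain.\<close>

lemma alternate_columns_separated:
  assumes u: "u \<in> {..<k} \<times> {..<2}" "u \<notin> alternate_columns k - {w}"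
    and v: "v \<in> {..<k} \<times> {..<2}" "v \<notin> alternate_columns k"
    and "u \<noteq> v" and w: "w \<in> alternate_columns k"
  shows "open_nbhd (path_graph k \<box> path_graph 2) u \<inter> (alternate_columns k - {w}) \<noteq>
         open_nbhd (path_graph k \<box> path_graph 2) v \<inter> (alternate_columns k - {w})"
    (is "?N u \<inter> ?T \<noteq> ?N v \<inter> ?T")
proof -
  obtain i a j b p q where ij: "u = (i, a)" "v = (j, b)" "w = (p, q)"
    by (cases u; cases v; cases w)
  have j: "odd j" "Suc j < k" "b < 2" using v ij by (auto simp: mem_alternate_columns)
  have v_nbr: "(j - 1, b) \<in> ?N v" "(Suc j, b) \<in> ?N v"
    "(j - 1, b) \<in> alternate_columns k" "(Suc j, b) \<in> alternate_columns k"
    using j ij by (auto simp: open_nbhd_ladder mem_alternate_columns elim!: oddE)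
  show ?thesis
  proof (cases "u = w")
    case True
    have a: "a < 2" "i < k" using u ij by auto
    show ?thesis
    proof (cases "b = a")
      case True
      obtain c where c: "c < 2" "c \<noteq> a" using other_row[of a] .
      \<comment> \<open>The partner of \<open>w\<close> in its own column separates: it lies in the
        other row, and \<open>v\<close> is in a different column.\<close>
      have "(i, c) \<in> ?N u \<inter> ?T" "(i, c) \<notin> ?N v"
        using a c ij w True \<open>u = w\<close> j
        by (auto simp: open_nbhd_ladder mem_alternate_columns)
      then show ?thesis by blast
    next
      case False
      have "(j - 1, b) \<in> ?N v \<inter> ?T" "(Suc j, b) \<in> ?N v \<inter> ?T"
        using v_nbr ij False \<open>u = w\<close> by auto
      \<comment> \<open>A vertex of row \<open>a\<close> has at most one neighbour in row
        \<open>b\<close>.\<close>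
      moreover have "(j - 1, b) \<notin> ?N u \<or> (Suc j, b) \<notin> ?N u"
        using ij False by (auto simp: open_nbhd_ladder)
      ultimately show ?thesis by blast
    qed
  next
    case False
    then have "u \<notin> alternate_columns k" using u by blast
    then have i: "odd i" "Suc i < k" "a < 2" using u ij by (auto simp: mem_alternate_columns)
    have u_nbr: "(i - 1, a) \<in> ?N u" "(Suc i, a) \<in> ?N u"
      "(i - 1, a) \<in> alternate_columns k" "(Suc i, a) \<in> alternate_columns k"
      using i ij by (auto simp: open_nbhd_ladder mem_alternate_columns elim!: oddE)
    consider "a \<noteq> b" | "a = b" "i < j" | "a = b" "j < i"
      using \<open>u \<noteq> v\<close> ij by fastforce
    then show ?thesis
    proof cases
      case 1
      \<comment> \<open>The only neighbour of \<open>v\<close> in row \<open>a\<close> is in the odd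
        column \<open>j\<close>, whereas \<open>i - 1\<close> and \<open>Suc i\<close> are
        even.\<close>
      have "(i - 1, a) \<notin> ?N v" "(Suc i, a) \<notin> ?N v"
        using 1 ij i j by (auto simp: open_nbhd_ladder)
      moreover have "(i - 1, a) \<noteq> w \<or> (Suc i, a) \<noteq> w" by auto
      ultimately show ?thesis using u_nbr by blast
    next
      case 2
      \<comment> \<open>In a common row the two outer neighbours separate: each is adjacent to only
        one of \<open>u\<close> and \<open>v\<close>, and \<open>w\<close> removes at most
        one.\<close>
      have "(i - 1, a) \<notin> ?N v" "(Suc j, b) \<notin> ?N u"
        using 2 ij i j by (auto simp: open_nbhd_ladder)
      moreover have "(i - 1, a) \<noteq> w \<or> (Suc j, b) \<noteq> w" using 2 by auto
      ultimately show ?thesis using u_nbr v_nbr by blast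
    next
      case 3
      have "(j - 1, b) \<notin> ?N u" "(Suc i, a) \<notin> ?N v"
        using 3 ij i j by (auto simp: open_nbhd_ladder)
      moreover have "(j - 1, b) \<noteq> w \<or> (Suc i, a) \<noteq> w" using 3 by auto
      ultimately show ?thesis using u_nbr v_nbr by blast
    qed
  qed
qed

text \<open>The deleted vertex is dominated by its partner in the same column; any other
  \<open>v\<close> has chosen neighbours on both sides, one of which differs from
  \<open>w\<close>.\<close>

lemma alternate_columns_dominated:
  assumes "v \<in> {..<k} \<times> {..<2}" "v \<notin> alternate_columns k - {w}" "w \<in> alternate_columns k"
  shows "open_nbhd (path_graph k \<box> path_graph 2) v \<inter> (alternate_columns k - {w}) \<noteq> {}"
    (is "?N v \<inter> ?T \<noteq> {}")
proof -
  obtain j b where v: "v = (j, b)" by (cases v)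
  show ?thesis
  proof (cases "v = w")
    case True
    obtain c where "c < 2" "c \<noteq> b" using other_row[of b] .
    then have "(j, c) \<in> ?N v \<inter> ?T"
      using True assms v by (auto simp: open_nbhd_ladder mem_alternate_columns)
    then show ?thesis by blast
  next
    case False
    then have "odd j" "Suc j < k" "b < 2" using assms v by (auto simp: mem_alternate_columns)
    then have "(j - 1, b) \<in> ?N v \<inter> alternate_columns k" "(Suc j, b) \<in> ?N v \<inter> alternate_columns k"
      using v by (auto simp: open_nbhd_ladder mem_alternate_columns elim!: oddE)
    moreover have "(j - 1, b) \<noteq> w \<or> (Suc j, b) \<noteq> w" by auto
    ultimately show ?thesis by blast
  qed
qed

lemma RED_LD_set_alternate_columns:
  assumes "0 < k"
  shows "RED_LD_set (path_graph k \<box> path_graph 2) (alternate_columns k)"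
proof -
  have sub: "alternate_columns k \<subseteq> pverts (path_graph k \<box> path_graph 2)"
    unfolding pverts_ladder by (auto simp: alternate_columns_def)
  have LD: "LD_set (path_graph k \<box> path_graph 2) (alternate_columns k - {w})"
    if w: "w \<in> alternate_columns k" for w
    unfolding LD_set_def
  proof (intro conjI ballI impI)
    fix u v
    assume "u \<in> pverts (path_graph k \<box> path_graph 2) - (alternate_columns k - {w})"
      "v \<in> pverts (path_graph k \<box> path_graph 2) - (alternate_columns k - {w})"
    then have u: "u \<in> {..<k} \<times> {..<2}" "u \<notin> alternate_columns k - {w}"
      and v: "v \<in> {..<k} \<times> {..<2}" "v \<notin> alternate_columns k - {w}"
      unfolding pverts_ladder by blast+
    show "open_nbhd (path_graph k \<box> path_graph 2) v \<inter> (alternate_columns k - {w}) \<noteq> {}"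
      by (rule alternate_columns_dominated[OF v w])
    assume "u \<noteq> v"
    \<comment> \<open>At most one of the distinct vertices is \<open>w\<close>, so the asymmetric
      separation lemma applies in one of the two orders.\<close>
    then consider "v \<notin> alternate_columns k" | "u \<notin> alternate_columns k"
      using u v by blast
    then show "open_nbhd (path_graph k \<box> path_graph 2) v \<inter> (alternate_columns k - {w}) \<noteq>
        open_nbhd (path_graph k \<box> path_graph 2) u \<inter> (alternate_columns k - {w})"
      using alternate_columns_separated[OF u v(1) _ _ w] alternate_columns_separated[OF v u(1) _ _ w]
        \<open>u \<noteq> v\<close> by cases metis+
  qed (use sub in blast)
  \<comment> \<open>Some vertex must be available for deletion, so that the LD property of the full
    set follows by monotonicity.\<close>
  moreover have "(0, 0) \<in> alternate_columns k"
    using assms by (simp add: mem_alternate_columns)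
  ultimately show ?thesis
    unfolding RED_LD_set_def using LD_set_mono[OF LD _ sub] by blast
qed

theorem theorem7:
  fixes k :: nat
  assumes "k \<ge> 1"
  shows "(odd k \<longrightarrow> RED_LD (path_graph k \<box> path_graph 2) = k + 1) \<and>
         (even k \<longrightarrow> RED_LD (path_graph k \<box> path_graph 2) = k + 2)"
proof -
  have k: "0 < k" using assms by simp
  have "RED_LD (path_graph k \<box> path_graph 2) = k + (if odd k then 1 else 2)"
    unfolding RED_LD_def
  proof (rule Least_equality)
    show "\<exists>S. RED_LD_set (path_graph k \<box> path_graph 2) S \<and> card S = k + (if odd k then 1 else 2)"
      using RED_LD_set_alternate_columns[OF k] card_alternate_columns[OF k] by blast
  next
    fix n
    assume "\<exists>S. RED_LD_set (path_graph k \<box> path_graph 2) S \<and> card S = n"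
    then obtain S where "RED_LD_set (path_graph k \<box> path_graph 2) S" "card S = n" by blast
    then show "k + (if odd k then 1 else 2) \<le> n"
      using ladder_RED_LD.card_ge[OF ladder_RED_LD.intro k] by blast
  qed
  then show ?thesis by simp
qed

end
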